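(* Let $\langle \mathcal{C},\sqsubseteq\rangle \overset{\alpha}{\underset{\gamma}{\rightleftarrows}} \langle \mathcal{A},\preccurlyeq\rangle$ be a Galois connection, where $\langle\mathcal{A},\preccurlyeq\rangle$ is a lattice with meet $\sqcap$. Let $e,e'\in\mathrm{Expr}$ be expressions with $e\cong e'$, and let $f:\mathcal{D}\to\mathcal{D}$ be a function such that $\llbracket e'\rrbracket_\rho = f(\llbracket e\rrbracket_\rho)$ for all $\rho\in I$ (so that $f(\llbracket e\rrbracket_\rho)=\llbracket e\rrbracket_\rho$ for all $\rho \in I$). Let $\bar f:\mathcal{A}\to\mathcal{A}$ be a sound abstraction of $f$, and define $\tilde f:\mathcal{A}\to\mathcal{A}$ by $\tilde f(a)=a\sqcap\bar f(a)$. Let $a_0\in\mathcal{A}$ be a sound abstraction of $\llbracket e\rrbracket$ and define $a_{n+1}=\tilde f(a_n)$ for $n\ge 0$. Then $a_n$ is a sound abstraction of $\llbracket e\rrbracket$ for all $n\in\mathbb{N}$.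
   Context: Expressions and semantics: $\mathcal{D}$ is a set (the domain of values), $I \subseteq \mathcal{D}^n$ is the set of allowed variable assignments (execution environments; here $n$ is the number of variables), and $\mathrm{Expr}$ is a set of expressions with a concrete semantics $\llbracket\cdot\rrbracket_{\cdot} \in \mathrm{Expr}\to I\to\mathcal{D}$; $\llbracket e\rrbracket_\rho\in\mathcal{D}$ is the value of $e$ under $\rho\in I$. Put $\llbracket e\rrbracket = \{\llbracket e\rrbracket_\rho \mid \rho\in I\}\subseteq\mathcal{D}$. Congruence: $e_a\cong e_b$ iff $\llbracket e_a\rrbracket_\rho=\llbracket e_b\rrbracket_\rho$ for all $\rho\in I$. In the motivating situation $e$ occurs as a subterm of $e'$ (a cycle in an e-graph), and $f$ is the interpretation of $e'$ as a function of the value of $e$, with all other subterms absorbed into $f$. Abstraction: the concrete domain $\langle\mathcal{C},\sqsubseteq\rangle$ is a poset whose elements are subsets of $\mathcal{D}$ (typically the power set of $\mathcal{D}$ ordered by inclusion) and which contains the sets $\llbracket e\rrbracket$. A pair $\alpha\in\mathcal{C}\to\mathcal{A}$, $\gamma\in\mathcal{A}\to\mathcal{C}$ is a Galois connection iff for all $P\in\mathcal{C}$ and $\overline{P}\in\mathcal{A}$: $\alpha(P)\preccurlyeq\overline{P}\Leftrightarrow P\sqsubseteq\gamma(\overline{P})$. An element $\overline{P}\in\mathcal{A}$ is a sound abstraction of $P\in\mathcal{C}$ iff $P\sqsubseteq\gamma(\overline{P})$. A function $\bar f:\mathcal{A}\to\mathcal{A}$ is a sound abstraction of $f:\mathcal{D}\to\mathcal{D}$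 iff whenever $a\in\mathcal{A}$ is a sound abstraction of $P\in\mathcal{C}$, the image $\{f(x)\mid x\in P\}$ belongs to $\mathcal{C}$ and $\bar f(a)$ is a sound abstraction of it, i.e. $\{f(x)\mid x\in P\}\sqsubseteq\gamma(\bar f(a))$. *)

theory Defs
  imports "HOL-Algebra.Galois_Connection"
begin

text \<open>
  The domain of values is the type \<open>'v\<close>, expressions are the type \<open>'e\<close>, and an
  environment in \<open>D^n\<close> is a list of length \<open>n\<close> over \<open>'v\<close>. A semantics
  \<open>sem e \<rho>\<close> is only meaningful (and only ever inspected) for \<open>\<rho>\<close> in the set \<open>I\<close>
  of allowed environments.
\<close>

definition values_of :: "('e \<Rightarrow> 'v list \<Rightarrow> 'v) \<Rightarrow> 'v list set \<Rightarrow> 'e \<Rightarrow> 'v set"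
  where "values_of sem I e = {sem e \<rho> |\<rho>. \<rho> \<in> I}"

definition expr_congruent :: "('e \<Rightarrow> 'v list \<Rightarrow> 'v) \<Rightarrow> 'v list set \<Rightarrow> 'e \<Rightarrow> 'e \<Rightarrow> bool"
  where "expr_congruent sem I e\<^sub>a e\<^sub>b \<longleftrightarrow> (\<forall>\<rho>\<in>I. sem e\<^sub>a \<rho> = sem e\<^sub>b \<rho>)"

text \<open>
  The concrete domain \<open>C\<close> is an arbitrary poset of subsets of \<open>'v\<close>; its order
  need not be inclusion. In the following two definitions membership in the carriers
  expresses the typing \<open>P \<in> C\<close>, \<open>a \<in> A\<close> and \<open>F : A \<rightarrow> A\<close>.
\<close>

definition sound_abstraction ::
  "'v set gorder \<Rightarrow> 'a gorder \<Rightarrow> ('a \<Rightarrow> 'v set) \<Rightarrow> 'a \<Rightarrow> 'v set \<Rightarrow> bool"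
  where "sound_abstraction C A \<gamma> a P \<longleftrightarrow>
    a \<in> carrier A \<and> P \<in> carrier C \<and> P \<sqsubseteq>\<^bsub>C\<^esub> \<gamma> a"

definition sound_fun_abstraction ::
  "'v set gorder \<Rightarrow> 'a gorder \<Rightarrow> ('a \<Rightarrow> 'v set) \<Rightarrow> ('a \<Rightarrow> 'a) \<Rightarrow> ('v \<Rightarrow> 'v) \<Rightarrow> bool"
  where "sound_fun_abstraction C A \<gamma> F f \<longleftrightarrow>
    F \<in> carrier A \<rightarrow> carrier A \<and>
    (\<forall>a P. sound_abstraction C A \<gamma> a P \<longrightarrow> sound_abstraction C A \<gamma> (F a) {f x |x. x \<in> P})"

definition meet_refinement :: "'a gorder \<Rightarrow> ('a \<Rightarrow> 'a) \<Rightarrow> 'a \<Rightarrow> 'a"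
  where "meet_refinement A F a = a \<sqinter>\<^bsub>A\<^esub> F a"

end

theory Submission
  imports Defs
begin

text \<open>
  Congruence makes every value of \<open>e\<close> a fixed point of \<open>f\<close>, so \<open>F a\<close> is a sound abstraction
  of the values of \<open>e\<close> whenever \<open>a\<close> is. By adjunction, soundness of \<open>a\<close> for \<open>P\<close> says that
  \<open>\<alpha> P\<close> is a lower bound of \<open>a\<close>, hence soundness is preserved by meets.
\<close>

text \<open>Moves soundness out of \<open>C\<close>, assumed only to be a poset, into
  \<open>A\<close>, where the meet lives.\<close>

lemma sound_abstraction_iff_lower:
  assumes "galois_connection \<lparr>orderA = C, orderB = A, lower = \<alpha>, upper = \<gamma>\<rparr>"
  shows "sound_abstraction C A \<gamma> a P \<longleftrightarrow>
    a \<in> carrier A \<and> P \<in> carrier C \<and> \<alpha> P \<sqsubseteq>\<^bsub>A\<^esub> a"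
  using galois_connection.galois_property[OF assms] by (auto simp: sound_abstraction_def)

lemma sound_abstraction_meet:
  assumes galois: "galois_connection \<lparr>orderA = C, orderB = A, lower = \<alpha>, upper = \<gamma>\<rparr>"
    and lattice: "lattice A"
    and "sound_abstraction C A \<gamma> a P" and "sound_abstraction C A \<gamma> b P"
  shows "sound_abstraction C A \<gamma> (a \<sqinter>\<^bsub>A\<^esub> b) P"
proof -
  interpret galois_connection "\<lparr>orderA = C, orderB = A, lower = \<alpha>, upper = \<gamma>\<rparr>"
    by (fact galois)
  interpret A: lattice A
    by (fact lattice)
  show ?thesis
    \<comment> \<open>\<open>lower_closed\<close> puts \<open>\<alpha> P\<close> into
      \<open>carrier A\<close>, as \<open>A.meet_le\<close> requires of a lower bound.\<close>
    using assms(3,4) lower_closed[of P]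
    by (auto simp: sound_abstraction_iff_lower[OF galois] intro: A.meet_le)
qed

text \<open>An equality of sets is wanted here, since the order of \<open>C\<close> need not be
  inclusion: it carries soundness over by rewriting alone.\<close>

lemma image_values_of_fixed:
  assumes "\<And>\<rho>. \<rho> \<in> I \<Longrightarrow> f (sem e \<rho>) = sem e \<rho>"
  shows "{f x |x. x \<in> values_of sem I e} = values_of sem I e"
  using assms unfolding values_of_def by (auto; metis)

theorem lemma4:
  fixes n :: nat
    and I :: "'v list set"
    and sem :: "'e \<Rightarrow> 'v list \<Rightarrow> 'v"
    and C :: "'v set gorder"
    and A :: "'a gorder"
    and \<alpha> :: "'v set \<Rightarrow> 'a"
    and \<gamma> :: "'a \<Rightarrow> 'v set"
    and e e' :: 'e
    and f :: "'v \<Rightarrow> 'v"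
    and F :: "'a \<Rightarrow> 'a"
    and a :: "nat \<Rightarrow> 'a"
  assumes environments: "I \<subseteq> {\<rho>. length \<rho> = n}"
    and values_in_C: "\<And>x. values_of sem I x \<in> carrier C"
    and galois: "galois_connection \<lparr>orderA = C, orderB = A, lower = \<alpha>, upper = \<gamma>\<rparr>"
    and lattice: "lattice A"
    and congruent: "expr_congruent sem I e e'"
    and interpretation_f: "\<And>\<rho>. \<rho> \<in> I \<Longrightarrow> sem e' \<rho> = f (sem e \<rho>)"
    and sound_F: "sound_fun_abstraction C A \<gamma> F f"
    and sound_0: "sound_abstraction C A \<gamma> (a 0) (values_of sem I e)"
    and step: "\<And>k. a (Suc k) = meet_refinement A F (a k)"
  shows "\<forall>k. sound_abstraction C A \<gamma> (a k) (values_of sem I e)"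
proof
  fix k
  have "f (sem e \<rho>) = sem e \<rho>" if "\<rho> \<in> I" for \<rho>
    using congruent interpretation_f that by (simp add: expr_congruent_def)
  then have image: "{f x |x. x \<in> values_of sem I e} = values_of sem I e"
    by (rule image_values_of_fixed)
  show "sound_abstraction C A \<gamma> (a k) (values_of sem I e)"
  proof (induction k)
    case 0
    show ?case by (fact sound_0)
  next
    case (Suc k)
    then have "sound_abstraction C A \<gamma> (F (a k)) {f x |x. x \<in> values_of sem I e}"
      using sound_F unfolding sound_fun_abstraction_def by blast
    \<comment> \<open>Rewriting with \<open>image\<close> makes \<open>a k\<close> and
      \<open>F (a k)\<close> abstractions of the same set, so their meet is one too.\<close>
    with Suc show ?case
      unfolding step meet_refinement_def image by (rule sound_abstraction_meet[OF galois lattice])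
  qed
qed

end
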